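(* Let $K$ be a connected finite simplicial complex and let $L\subseteq K$ be a non-empty subcomplex of $K$. Then \[ scat(K)\leq TC(K,L)\leq scat(K\textstyle\prod K). \]
   Context: Simplicial complexes are abstract simplicial complexes. The categorical product $K\prod L$ of simplicial complexes has vertex set $V(K)\times V(L)$, and a finite set $\sigma$ of vertices is a simplex iff its projections $p_1(\sigma)$ and $p_2(\sigma)$ are simplices of $K$ and $L$ respectively. Two simplicial maps $\phi,\psi:K\to M$ are contiguous, $\phi\sim_c\psi$, if $\phi(\sigma)\cup\psi(\sigma)$ is a simplex of $M$ for every simplex $\sigma$ of $K$. They are in the same contiguity class, $\phi\sim\psi$, if there is a finite sequence of simplicial maps $\phi=\phi_0\sim_c\phi_1\sim_c\cdots\sim_c\phi_n=\psi$. For a subcomplex $L\subseteq K$, the targeted simplicial complexity $TC(K,L)$ is the least integer $n\ge 0$ such that $K\prod L$ can be covered by $n+1$ subcomplexes $\Omega_0,\dots,\Omega_n$ such that for each $i$ there is a simplicial map $\sigma_i:\Omega_i\to L$ with $\Delta_L\circ\sigma_i\sim i_{\Omega_i}$, where $\Delta_L:L\to K\prod L$, $\Delta_L(v)=(v,v)$, and $i_{\Omega_i}:\Omega_i\to K\prod L$ is the inclusion. A subcomplex $U\subseteq K$ is categorical if there is a vertex $v\in K$ such that the inclusion $U\hookrightarrow K$ and the constant map $c_v:U\to K$ are in the same contiguity class. The simplicial LS-category $scat(K)$ is the least integer $n\ge 0$ such that $K$ can be covered by $n+1$ categorical subcomplexes. *)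

theory Defs
  imports Main "HOL-Library.Extended_Nat"
begin

text \<open>
  An abstract simplicial complex is given by its set of simplices. Simplices are nonempty,
  so a complex is empty iff it has no vertices, and every vertex spans a simplex.
\<close>

definition simplicial_complex :: "'a set set \<Rightarrow> bool" where
  "simplicial_complex K \<longleftrightarrow>
     (\<forall>\<sigma>\<in>K. finite \<sigma> \<and> \<sigma> \<noteq> {} \<and> (\<forall>\<tau>. \<tau> \<subseteq> \<sigma> \<and> \<tau> \<noteq> {} \<longrightarrow> \<tau> \<in> K))"

definition vertices :: "'a set set \<Rightarrow> 'a set" where
  "vertices K = \<Union>K"

definition subcomplex :: "'a set set \<Rightarrow> 'a set set \<Rightarrow> bool" where
  "subcomplex L K \<longleftrightarrow> simplicial_complex L \<and> L \<subseteq> K"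

definition connected_complex :: "'a set set \<Rightarrow> bool" where
  "connected_complex K \<longleftrightarrow>
     (\<forall>u\<in>vertices K. \<forall>v\<in>vertices K. (\<lambda>x y. {x, y} \<in> K)\<^sup>*\<^sup>* u v)"

definition cat_prod :: "'a set set \<Rightarrow> 'b set set \<Rightarrow> ('a \<times> 'b) set set" where
  "cat_prod K L =
     {\<sigma>. finite \<sigma> \<and> \<sigma> \<subseteq> vertices K \<times> vertices L \<and> fst ` \<sigma> \<in> K \<and> snd ` \<sigma> \<in> L}"

text \<open>
  Maps between complexes are total HOL functions, of which only the values on vertices matter.
  In particular, two simplicial maps that agree on the vertices are contiguous, so being in the
  same contiguity class does not depend on the values elsewhere.
\<close>

definition simplicial_map :: "'a set set \<Rightarrow> 'b set set \<Rightarrow> ('a \<Rightarrow> 'b) \<Rightarrow> bool" where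
  "simplicial_map K M \<phi> \<longleftrightarrow> (\<forall>\<sigma>\<in>K. \<phi> ` \<sigma> \<in> M)"

definition contiguous :: "'a set set \<Rightarrow> 'b set set \<Rightarrow> ('a \<Rightarrow> 'b) \<Rightarrow> ('a \<Rightarrow> 'b) \<Rightarrow> bool" where
  "contiguous K M \<phi> \<psi> \<longleftrightarrow>
     simplicial_map K M \<phi> \<and> simplicial_map K M \<psi> \<and> (\<forall>\<sigma>\<in>K. \<phi> ` \<sigma> \<union> \<psi> ` \<sigma> \<in> M)"

definition same_contiguity_class ::
    "'a set set \<Rightarrow> 'b set set \<Rightarrow> ('a \<Rightarrow> 'b) \<Rightarrow> ('a \<Rightarrow> 'b) \<Rightarrow> bool" where
  "same_contiguity_class K M \<phi> \<psi> \<longleftrightarrow>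
     simplicial_map K M \<phi> \<and> simplicial_map K M \<psi> \<and> (contiguous K M)\<^sup>*\<^sup>* \<phi> \<psi>"

definition covered_by :: "'a set set \<Rightarrow> nat \<Rightarrow> (nat \<Rightarrow> 'a set set) \<Rightarrow> bool" where
  "covered_by K n \<Omega> \<longleftrightarrow> (\<forall>i\<le>n. subcomplex (\<Omega> i) K) \<and> K = (\<Union>i\<le>n. \<Omega> i)"

text \<open>
  The two invariants below are infima in \<^typ>\<open>enat\<close>: the least such \<open>n\<close> if there is one,
  and \<open>\<infinity>\<close> otherwise. Members of a cover may be empty or repeated.
\<close>

definition TC :: "'a set set \<Rightarrow> 'a set set \<Rightarrow> enat" where
  "TC K L = Inf {enat n | n. \<exists>\<Omega>. covered_by (cat_prod K L) n \<Omega> \<and>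
     (\<forall>i\<le>n. \<exists>s. simplicial_map (\<Omega> i) L s \<and>
        same_contiguity_class (\<Omega> i) (cat_prod K L) ((\<lambda>v. (v, v)) \<circ> s) (\<lambda>x. x))}"

definition categorical :: "'a set set \<Rightarrow> 'a set set \<Rightarrow> bool" where
  "categorical K U \<longleftrightarrow> subcomplex U K \<and>
     (\<exists>v\<in>vertices K. same_contiguity_class U K (\<lambda>x. x) (\<lambda>_. v))"

definition scat :: "'a set set \<Rightarrow> enat" where
  "scat K = Inf {enat n | n. \<exists>U. covered_by K n U \<and> (\<forall>i\<le>n. categorical K (U i))}"

end

theory Submission
  imports Defs
begin

text \<open>
  A section \<open>s\<close> over \<open>\<Omega> \<subseteq> K \<times> L\<close> (with \<open>\<Delta> \<circ> s\<close> in the contiguity class of the inclusion) says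
  that both projections \<open>p\<^sub>1\<close> and \<open>p\<^sub>2\<close> are in the class of \<open>s\<close>, the first among maps into \<open>K\<close>
  and the second among maps into \<open>L\<close>. Both inequalities come from this remark.

  For the lower bound, fix a vertex \<open>v\<close> of \<open>L\<close> and pull a cover of \<open>K \<times> L\<close> back along
  \<open>x \<mapsto> (x, v)\<close>. On each piece \<open>p\<^sub>1\<close> becomes the inclusion into \<open>K\<close> and \<open>p\<^sub>2\<close> the constant map
  at \<open>v\<close>; both are in the class of the pulled back section, so the piece is categorical
  (\<open>categorical_slice\<close>).

  For the upper bound, intersect a categorical cover of \<open>K \<times> K\<close> with \<open>K \<times> L\<close>. A contiguity
  in \<open>K \<times> K\<close> may move the second coordinate out of \<open>L\<close>, so it cannot be reused as it stands.
  Taking \<open>s = p\<^sub>2\<close> avoids this: the second coordinate then never has to move, and it remains to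
  join \<open>p\<^sub>1\<close> to \<open>p\<^sub>2\<close> among maps into \<open>K\<close>. There each of them is in the class of a constant map,
  and the constant maps at vertices of the connected complex \<open>K\<close> are all in one class
  (\<open>categorical_imp_section\<close>).
\<close>

section \<open>Simplices\<close>

lemma simplex_finite: "finite \<sigma>"
  and simplex_nonempty: "\<sigma> \<noteq> {}"
  and simplex_face: "\<lbrakk>\<tau> \<subseteq> \<sigma>; \<tau> \<noteq> {}\<rbrakk> \<Longrightarrow> \<tau> \<in> K"
  if "simplicial_complex K" "\<sigma> \<in> K"
proof -
  have "finite \<sigma> \<and> \<sigma> \<noteq> {} \<and> (\<forall>\<tau>. \<tau> \<subseteq> \<sigma> \<and> \<tau> \<noteq> {} \<longrightarrow> \<tau> \<in> K)"
    using that(1)[unfolded simplicial_complex_def] that(2) by (rule bspec)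
  then show "finite \<sigma>" "\<sigma> \<noteq> {}" "\<lbrakk>\<tau> \<subseteq> \<sigma>; \<tau> \<noteq> {}\<rbrakk> \<Longrightarrow> \<tau> \<in> K"
    by iprover+
qed

lemma simplicial_complex_Int:
  assumes "simplicial_complex K" "simplicial_complex L"
  shows "simplicial_complex (K \<inter> L)"
  unfolding simplicial_complex_def
proof (intro ballI conjI allI impI)
  fix \<sigma> assume "\<sigma> \<in> K \<inter> L"
  then have \<sigma>: "\<sigma> \<in> K" "\<sigma> \<in> L" by simp_all
  show "finite \<sigma>" "\<sigma> \<noteq> {}"
    using simplex_finite[OF assms(1) \<sigma>(1)] simplex_nonempty[OF assms(1) \<sigma>(1)] .
  fix \<tau> assume "\<tau> \<subseteq> \<sigma> \<and> \<tau> \<noteq> {}"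
  then show "\<tau> \<in> K \<inter> L"
    using simplex_face[OF assms(1) \<sigma>(1)] simplex_face[OF assms(2) \<sigma>(2)] by simp
qed

section \<open>Contiguity classes\<close>

lemma same_class_sym:
  assumes "same_contiguity_class K M \<phi> \<psi>"
  shows "same_contiguity_class K M \<psi> \<phi>"
proof -
  have "symp (contiguous K M)"
    by (auto simp: symp_def contiguous_def Un_commute)
  then have "symp (contiguous K M)\<^sup>*\<^sup>*"
    by (rule symp_rtranclp)
  then show ?thesis
    using assms by (auto simp: same_contiguity_class_def dest: sympD)
qed

lemma same_class_trans:
  assumes "same_contiguity_class K M \<phi> \<psi>" "same_contiguity_class K M \<psi> \<chi>"
  shows "same_contiguity_class K M \<phi> \<chi>"
  using assms by (auto simp: same_contiguity_class_def)

text \<open>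
  Any operation on maps that preserves contiguity acts on contiguity classes. Composition with a
  simplicial map, restriction, and pairing with a fixed map are all of this form.
\<close>

lemma same_class_map:
  assumes "same_contiguity_class K M \<phi> \<psi>"
    and step: "\<And>\<alpha> \<beta>. contiguous K M \<alpha> \<beta> \<Longrightarrow> contiguous K' M' (F \<alpha>) (F \<beta>)"
  shows "same_contiguity_class K' M' (F \<phi>) (F \<psi>)"
proof -
  have simp_F: "simplicial_map K' M' (F \<alpha>)" if "simplicial_map K M \<alpha>" for \<alpha>
    using step[of \<alpha> \<alpha>] that by (auto simp: contiguous_def simplicial_map_def)
  have "(contiguous K M)\<^sup>*\<^sup>* \<phi> \<psi>"
    using assms(1) by (simp add: same_contiguity_class_def)
  then have "(contiguous K' M')\<^sup>*\<^sup>* (F \<phi>) (F \<psi>)"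
    by induction (auto intro: rtranclp.rtrancl_into_rtrancl step)
  then show ?thesis
    using assms(1) simp_F by (simp add: same_contiguity_class_def)
qed

lemma same_class_comp:
  assumes "same_contiguity_class K M \<phi> \<psi>"
    and "simplicial_map K' K f" and "simplicial_map M M' g"
  shows "same_contiguity_class K' M' (\<lambda>x. g (\<phi> (f x))) (\<lambda>x. g (\<psi> (f x)))"
proof (rule same_class_map[OF assms(1), where F = "\<lambda>\<alpha> x. g (\<alpha> (f x))"])
  fix \<alpha> \<beta> assume c: "contiguous K M \<alpha> \<beta>"
  have eq: "(\<lambda>x. g (\<gamma> (f x))) ` \<sigma> = g ` \<gamma> ` f ` \<sigma>" for \<gamma> \<sigma>
    by (simp add: image_image)
  show "contiguous K' M' (\<lambda>x. g (\<alpha> (f x))) (\<lambda>x. g (\<beta> (f x)))"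
    using c assms(2,3) unfolding contiguous_def simplicial_map_def eq
    by (simp flip: image_Un)
qed

text \<open>An edge path from \<open>u\<close> to \<open>v\<close> is a chain of contiguities between constant maps.\<close>

lemma same_class_const:
  assumes K: "simplicial_complex K" "connected_complex K"
    and uv: "u \<in> vertices K" "v \<in> vertices K"
    and U: "simplicial_complex U"
  shows "same_contiguity_class U K (\<lambda>_. u) (\<lambda>_. v)"
proof -
  have const: "(\<lambda>_. w) ` \<sigma> = {w}" if "\<sigma> \<in> U" for w :: 'a and \<sigma>
    using simplex_nonempty[OF U that] by (simp add: image_constant_conv)
  have vertex: "{w} \<in> K" if "w \<in> \<tau>" "\<tau> \<in> K" for w \<tau>
    using simplex_face[OF K(1) that(2)] that(1) by simp
  have step: "contiguous U K (\<lambda>_. x) (\<lambda>_. y)" if "{x, y} \<in> K" for x y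
    using that vertex[OF _ that]
    by (simp add: contiguous_def simplicial_map_def const insert_commute)
  have "(\<lambda>x y. {x, y} \<in> K)\<^sup>*\<^sup>* u v"
    using K(2) uv by (simp add: connected_complex_def)
  then have "(contiguous U K)\<^sup>*\<^sup>* (\<lambda>_. u) (\<lambda>_. v)"
    by induction (auto intro: rtranclp.rtrancl_into_rtrancl step)
  then show ?thesis
    using uv by (auto simp: same_contiguity_class_def simplicial_map_def const vertices_def
        intro: vertex)
qed

section \<open>The categorical product\<close>

lemma simplicial_fst: "simplicial_map (cat_prod K L) K fst"
  and simplicial_snd: "simplicial_map (cat_prod K L) L snd"
  by (auto simp: simplicial_map_def cat_prod_def)

lemma simplicial_map_mono:
  assumes "simplicial_map K M \<phi>" "K' \<subseteq> K" "M \<subseteq> M'"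
  shows "simplicial_map K' M' \<phi>"
  using assms by (auto simp: simplicial_map_def)

lemma vertices_cat_prodD:
  assumes "p \<in> vertices (cat_prod K L)"
  shows "fst p \<in> vertices K" "snd p \<in> vertices L"
  using assms by (auto simp: vertices_def cat_prod_def)

lemma in_cat_prodI:
  assumes "finite \<sigma>" "fst ` \<sigma> \<in> K" "snd ` \<sigma> \<in> L"
  shows "\<sigma> \<in> cat_prod K L"
  using assms by (force simp: cat_prod_def vertices_def)

lemma cat_prod_mono:
  assumes "K \<subseteq> K'" "L \<subseteq> L'"
  shows "cat_prod K L \<subseteq> cat_prod K' L'"
proof
  fix \<sigma> assume "\<sigma> \<in> cat_prod K L"
  then have "finite \<sigma>" "fst ` \<sigma> \<in> K'" "snd ` \<sigma> \<in> L'"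
    using assms by (auto simp: cat_prod_def)
  then show "\<sigma> \<in> cat_prod K' L'"
    by (rule in_cat_prodI)
qed

lemma simplicial_complex_cat_prod:
  assumes "simplicial_complex K" "simplicial_complex L"
  shows "simplicial_complex (cat_prod K L)"
  unfolding simplicial_complex_def
proof (intro ballI conjI allI impI)
  fix \<sigma> assume \<sigma>: "\<sigma> \<in> cat_prod K L"
  then show "finite \<sigma>" and "\<sigma> \<noteq> {}"
    using assms by (auto simp: cat_prod_def simplicial_complex_def)
  fix \<tau> assume \<tau>: "\<tau> \<subseteq> \<sigma> \<and> \<tau> \<noteq> {}"
  show "\<tau> \<in> cat_prod K L"
  proof (rule in_cat_prodI)
    show "finite \<tau>"
      using \<sigma> \<tau> by (auto simp: cat_prod_def intro: finite_subset)
    have "fst ` \<tau> \<subseteq> fst ` \<sigma>" "fst ` \<tau> \<noteq> {}" "fst ` \<sigma> \<in> K"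
      using \<sigma> \<tau> by (auto simp: cat_prod_def)
    then show "fst ` \<tau> \<in> K"
      using simplex_face[OF assms(1)] by metis
    have "snd ` \<tau> \<subseteq> snd ` \<sigma>" "snd ` \<tau> \<noteq> {}" "snd ` \<sigma> \<in> L"
      using \<sigma> \<tau> by (auto simp: cat_prod_def)
    then show "snd ` \<tau> \<in> L"
      using simplex_face[OF assms(2)] by metis
  qed
qed

text \<open>
  Only the first coordinate is deformed here. This is what keeps the deformation inside
  \<open>K \<times> L\<close> when the contiguity is known only in \<open>K\<close>.
\<close>

lemma same_class_pair:
  assumes "same_contiguity_class U K \<phi> \<psi>" and "simplicial_map U L \<theta>"
    and U: "simplicial_complex U"
  shows "same_contiguity_class U (cat_prod K L) (\<lambda>x. (\<phi> x, \<theta> x)) (\<lambda>x. (\<psi> x, \<theta> x))"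
proof (rule same_class_map[OF assms(1), where F = "\<lambda>\<alpha> x. (\<alpha> x, \<theta> x)"])
  fix \<alpha> \<beta> assume c: "contiguous U K \<alpha> \<beta>"
  have fin: "finite \<sigma>" if "\<sigma> \<in> U" for \<sigma>
    using that U by (simp add: simplicial_complex_def)
  show "contiguous U (cat_prod K L) (\<lambda>x. (\<alpha> x, \<theta> x)) (\<lambda>x. (\<beta> x, \<theta> x))"
    using c assms(2) fin unfolding contiguous_def simplicial_map_def
    by (auto intro!: in_cat_prodI simp: image_Un image_image)
qed

section \<open>Categorical pieces and sections\<close>

text \<open>
  Along the slice \<open>x \<mapsto> (x, v)\<close> the two coordinates of the contiguity from \<open>\<Delta> \<circ> s\<close> to the
  inclusion both start at the map \<open>x \<mapsto> s (x, v)\<close>; the first ends at the identity and the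
  second at the constant \<open>v\<close>. Going back along one and on along the other contracts \<open>U\<close> in \<open>K\<close>.
\<close>

lemma categorical_slice:
  assumes L: "subcomplex L K" and v: "v \<in> vertices L"
    and \<Omega>: "\<Omega> \<subseteq> cat_prod K L" and s: "simplicial_map \<Omega> L s"
    and cls: "same_contiguity_class \<Omega> (cat_prod K L) ((\<lambda>v. (v, v)) \<circ> s) (\<lambda>x. x)"
    and U: "subcomplex U K" and slice: "simplicial_map U \<Omega> (\<lambda>x. (x, v))"
  shows "categorical K U"
proof -
  have "same_contiguity_class U K (\<lambda>x. s (x, v)) (\<lambda>x. x)"
    using same_class_comp[OF cls slice simplicial_fst] by simp
  moreover have "simplicial_map (cat_prod K L) K snd"
    using simplicial_map_mono[OF simplicial_snd] L by (auto simp: subcomplex_def)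
  then have "same_contiguity_class U K (\<lambda>x. s (x, v)) (\<lambda>_. v)"
    using same_class_comp[OF cls slice] by fastforce
  ultimately have "same_contiguity_class U K (\<lambda>x. x) (\<lambda>_. v)"
    by (blast intro: same_class_sym same_class_trans)
  moreover have "v \<in> vertices K"
    using v L by (auto simp: vertices_def subcomplex_def)
  ultimately show ?thesis
    using U by (auto simp: categorical_def)
qed

text \<open>
  The map \<open>\<Delta> \<circ> snd\<close> and the inclusion have the same second coordinate, so it suffices that \<open>fst\<close>
  and \<open>snd\<close> are in one class among maps into \<open>K\<close>. The contraction of \<open>W\<close> to \<open>p\<close> takes them to
  the constants at the two coordinates of \<open>p\<close>, which an edge path in \<open>K\<close> connects.
\<close>

lemma categorical_imp_section:
  assumes K: "simplicial_complex K" "connected_complex K"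
    and W: "categorical (cat_prod K K) W"
    and \<Omega>: "simplicial_complex \<Omega>" "\<Omega> \<subseteq> W" "\<Omega> \<subseteq> cat_prod K L"
  shows "same_contiguity_class \<Omega> (cat_prod K L) ((\<lambda>v. (v, v)) \<circ> snd) (\<lambda>x. x)"
proof -
  obtain p where p: "p \<in> vertices (cat_prod K K)"
    and cls: "same_contiguity_class W (cat_prod K K) (\<lambda>x. x) (\<lambda>_. p)"
    using W by (auto simp: categorical_def)
  have incl: "simplicial_map \<Omega> W (\<lambda>x. x)"
    using \<Omega>(2) by (auto simp: simplicial_map_def)
  have "same_contiguity_class \<Omega> K fst (\<lambda>_. fst p)"
    using same_class_comp[OF cls incl simplicial_fst] by simp
  moreover have "same_contiguity_class \<Omega> K snd (\<lambda>_. snd p)"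
    using same_class_comp[OF cls incl simplicial_snd] by simp
  moreover have "same_contiguity_class \<Omega> K (\<lambda>_. fst p) (\<lambda>_. snd p)"
    using same_class_const[OF K vertices_cat_prodD[OF p] \<Omega>(1)] .
  ultimately have "same_contiguity_class \<Omega> K snd fst"
    by (blast intro: same_class_sym same_class_trans)
  from same_class_pair[OF this simplicial_map_mono[OF simplicial_snd \<Omega>(3) order.refl] \<Omega>(1)]
  show ?thesis
    by (simp add: comp_def)
qed

section \<open>The two inequalities\<close>

lemma scat_le_TC:
  assumes K: "simplicial_complex K" and L: "subcomplex L K" "L \<noteq> {}"
  shows "scat K \<le> TC K L"
proof -
  have scL: "simplicial_complex L"
    using L(1) by (simp add: subcomplex_def)
  obtain \<tau> where \<tau>: "\<tau> \<in> L"
    using L(2) by blast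
  then obtain v where v: "v \<in> \<tau>"
    using simplex_nonempty[OF scL \<tau>] by blast
  then have vL: "{v} \<in> L"
    using simplex_face[OF scL \<tau>] by simp
  have "\<exists>U. covered_by K n U \<and> (\<forall>i\<le>n. categorical K (U i))"
    if cov: "covered_by (cat_prod K L) n \<Omega>"
      and sec: "\<forall>i\<le>n. \<exists>s. simplicial_map (\<Omega> i) L s \<and>
        same_contiguity_class (\<Omega> i) (cat_prod K L) ((\<lambda>v. (v, v)) \<circ> s) (\<lambda>x. x)" for n \<Omega>
  proof -
    define U where "U i = {\<sigma> \<in> K. (\<lambda>x. (x, v)) ` \<sigma> \<in> \<Omega> i}" for i
    have sub: "subcomplex (U i) K" if "i \<le> n" for i
      unfolding subcomplex_def simplicial_complex_def
    proof (intro conjI ballI allI impI)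
      fix \<sigma> assume \<sigma>: "\<sigma> \<in> U i"
      then have "\<sigma> \<in> K" by (simp add: U_def)
      then show "finite \<sigma>" "\<sigma> \<noteq> {}"
        by (rule simplex_finite[OF K], rule simplex_nonempty[OF K])
      fix \<rho> assume \<rho>: "\<rho> \<subseteq> \<sigma> \<and> \<rho> \<noteq> {}"
      have "\<rho> \<in> K"
        using \<sigma> \<rho> by (auto simp: U_def intro: simplex_face[OF K])
      moreover have sc: "simplicial_complex (\<Omega> i)"
        using cov that by (auto simp: covered_by_def subcomplex_def)
      have "(\<lambda>x. (x, v)) ` \<rho> \<in> \<Omega> i"
        by (rule simplex_face[OF sc, of "(\<lambda>x. (x, v)) ` \<sigma>"]) (use \<sigma> \<rho> in \<open>auto simp: U_def\<close>)
      ultimately show "\<rho> \<in> U i" by (simp add: U_def)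
    qed (auto simp: U_def)
    have "\<exists>i\<le>n. \<sigma> \<in> U i" if \<sigma>: "\<sigma> \<in> K" for \<sigma>
    proof -
      have "finite \<sigma>" "\<sigma> \<noteq> {}"
        using simplex_finite[OF K \<sigma>] simplex_nonempty[OF K \<sigma>] .
      then have "(\<lambda>x. (x, v)) ` \<sigma> \<in> cat_prod K L"
        using \<sigma> vL by (intro in_cat_prodI) (simp_all add: image_image image_constant_conv)
      then show ?thesis
        using cov \<sigma> by (auto simp: covered_by_def U_def)
    qed
    then have "covered_by K n U"
      using sub by (auto simp: covered_by_def U_def)
    moreover have "categorical K (U i)" if "i \<le> n" for i
    proof -
      obtain s where "simplicial_map (\<Omega> i) L s"
        and "same_contiguity_class (\<Omega> i) (cat_prod K L) ((\<lambda>v. (v, v)) \<circ> s) (\<lambda>x. x)"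
        using sec \<open>i \<le> n\<close> by blast
      moreover have "\<Omega> i \<subseteq> cat_prod K L"
        using cov \<open>i \<le> n\<close> by (auto simp: covered_by_def subcomplex_def)
      moreover have "v \<in> vertices L"
        using v \<tau> by (auto simp: vertices_def)
      moreover have "simplicial_map (U i) (\<Omega> i) (\<lambda>x. (x, v))"
        by (auto simp: U_def simplicial_map_def)
      ultimately show ?thesis
        using categorical_slice[OF L(1)] sub[OF \<open>i \<le> n\<close>] by blast
    qed
    ultimately show ?thesis by blast
  qed
  then show ?thesis
    unfolding scat_def TC_def by (intro Inf_superset_mono) blast
qed

lemma TC_le_scat_cat_prod:
  assumes K: "simplicial_complex K" "connected_complex K" and L: "subcomplex L K"
  shows "TC K L \<le> scat (cat_prod K K)"
proof -
  have "\<exists>\<Omega>. covered_by (cat_prod K L) n \<Omega> \<and>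
     (\<forall>i\<le>n. \<exists>s. simplicial_map (\<Omega> i) L s \<and>
        same_contiguity_class (\<Omega> i) (cat_prod K L) ((\<lambda>v. (v, v)) \<circ> s) (\<lambda>x. x))"
    if cov: "covered_by (cat_prod K K) n W"
      and cat: "\<forall>i\<le>n. categorical (cat_prod K K) (W i)" for n W
  proof -
    define \<Omega> where "\<Omega> i = W i \<inter> cat_prod K L" for i
    have sc: "simplicial_complex (\<Omega> i)" if "i \<le> n" for i
    proof -
      have "simplicial_complex (W i)"
        using cov that by (simp add: covered_by_def subcomplex_def)
      moreover have "simplicial_complex (cat_prod K L)"
        using K(1) L by (intro simplicial_complex_cat_prod) (auto simp: subcomplex_def)
      ultimately show ?thesis
        unfolding \<Omega>_def by (rule simplicial_complex_Int)
    qed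
    have "cat_prod K L \<subseteq> cat_prod K K"
      using L by (intro cat_prod_mono) (auto simp: subcomplex_def)
    then have "covered_by (cat_prod K L) n \<Omega>"
      using cov sc by (auto simp: covered_by_def subcomplex_def \<Omega>_def)
    moreover have "simplicial_map (\<Omega> i) L snd" for i
      by (rule simplicial_map_mono[OF simplicial_snd[of K]]) (auto simp: \<Omega>_def)
    moreover have
      "same_contiguity_class (\<Omega> i) (cat_prod K L) ((\<lambda>v. (v, v)) \<circ> snd) (\<lambda>x. x)" if "i \<le> n" for i
      using categorical_imp_section[OF K cat[rule_format, OF that] sc[OF that]]
      by (auto simp: \<Omega>_def)
    ultimately show ?thesis by blast
  qed
  then show ?thesis
    unfolding scat_def TC_def by (intro Inf_superset_mono) blast
qed

theorem proposition4p4: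
  fixes K L :: "'a set set"
  assumes "simplicial_complex K" and "finite K" and "connected_complex K"
    and "subcomplex L K" and "L \<noteq> {}"
  shows "scat K \<le> TC K L \<and> TC K L \<le> scat (cat_prod K K)"
  using scat_le_TC[OF assms(1,4,5)] TC_le_scat_cat_prod[OF assms(1,3,4)] by blast

end
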